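(* Let $G=(V,E)$ be a finite simple graph with node weights $w\in\mathbb{R}^V_+$ and edge weights satisfying $w_{ij}\ge\max\{w_i,w_j\}$ for all edges $ij\in E$. If $G$ is perfect, then $\mathrm{rk}_H(G,w)\le\omega(G)$. Moreover, in the unweighted case, if $G$ is perfect and vertex-transitive, then $\mathrm{rk}_H(G)=\omega(G)$.
   Context: $\omega(G)$ is the maximum cardinality of a clique of $G$. $G$ is perfect if $\omega(H)=\chi(H)$ (chromatic number) for all induced subgraphs $H$ of $G$. Let $V=[n]$. $\alpha(G,w)$ is the maximum of $w(S)=\sum_{i\in S}w_i$ over stable sets $S$ of $G$. For $I\subseteq V$ write $x^I=\prod_{i\in I}x_i$ and $(1-x)^I=\prod_{i\in I}(1-x_i)$. For an integer $t\ge 1$, $$H_t=\Big\{\sum_{T\subseteq V,\ |T|\le t}\ \sum_{I\subseteq T}c_{T,I}\,x^I(1-x)^{T\setminus I}:\ c_{T,I}\ge 0\Big\}\subseteq\mathbb{R}[x_1,\dots,x_n].$$ Set $p_{G,w}=\sum_{i\in V}w_ix_i-\sum_{ij\in E}w_{ij}x_ix_j$ and $p_{\mathrm{han}}^{(t)}(G,w)=\inf\{\lambda\in\mathbb{R}:\lambda-p_{G,w}\in H_t\}$. The Handelman rank $\mathrm{rk}_H(G,w)$ is the smallest integer $t\ge1$ for which $p_{\mathrm{han}}^{(t)}(G,w)=\alpha(G,w)$; equivalently, the smallest $t$ for which $\alpha(G,w)-p_{G,w}\in H_t$. In the unweighted case ($w_i=1$ for all $i\in V$ and $w_{ij}=1$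 for all $ij\in E$) one writes $\mathrm{rk}_H(G)$. *)

theory Defs
  imports "HOL-Library.Poly_Mapping" "HOL-Library.Extended_Real" "HOL-Library.Ramsey"
begin

definition finite_simple_graph :: "'a set \<Rightarrow> 'a set set \<Rightarrow> bool" where
  "finite_simple_graph V E \<longleftrightarrow> finite V \<and> E \<subseteq> [V]\<^bsup>2\<^esup>"

definition induced_edges :: "'a set set \<Rightarrow> 'a set \<Rightarrow> 'a set set" where
  "induced_edges E U = {e \<in> E. e \<subseteq> U}"

definition clique_number :: "'a set \<Rightarrow> 'a set set \<Rightarrow> nat" where
  "clique_number V E = Max {card K | K. K \<subseteq> V \<and> clique K E}"

definition proper_colouring :: "'a set \<Rightarrow> 'a set set \<Rightarrow> nat \<Rightarrow> ('a \<Rightarrow> nat) \<Rightarrow> bool" where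
  "proper_colouring V E k f \<longleftrightarrow>
     (\<forall>v\<in>V. f v < k) \<and> (\<forall>u\<in>V. \<forall>v\<in>V. {u, v} \<in> E \<longrightarrow> f u \<noteq> f v)"

definition chromatic_number :: "'a set \<Rightarrow> 'a set set \<Rightarrow> nat" where
  "chromatic_number V E = (LEAST k. \<exists>f. proper_colouring V E k f)"

definition perfect_graph :: "'a set \<Rightarrow> 'a set set \<Rightarrow> bool" where
  "perfect_graph V E \<longleftrightarrow>
     (\<forall>U \<subseteq> V. clique_number U (induced_edges E U) = chromatic_number U (induced_edges E U))"

definition graph_automorphism :: "'a set \<Rightarrow> 'a set set \<Rightarrow> ('a \<Rightarrow> 'a) \<Rightarrow> bool" where
  "graph_automorphism V E f \<longleftrightarrow>
     bij_betw f V V \<and> (\<forall>u\<in>V. \<forall>v\<in>V. {u, v} \<in> E \<longleftrightarrow> {f u, f v} \<in> E)"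

definition vertex_transitive :: "'a set \<Rightarrow> 'a set set \<Rightarrow> bool" where
  "vertex_transitive V E \<longleftrightarrow> (\<forall>u\<in>V. \<forall>v\<in>V. \<exists>f. graph_automorphism V E f \<and> f u = v)"

definition weighted_stability_number :: "'a set \<Rightarrow> 'a set set \<Rightarrow> ('a \<Rightarrow> real) \<Rightarrow> real" where
  "weighted_stability_number V E w = Max {sum w S | S. S \<subseteq> V \<and> indep S E}"

text \<open>
  A real polynomial in variables indexed by \<^typ>\<open>'a\<close> is a finitely supported map from monomials
  (finitely supported exponent vectors) to coefficients; the ring structure on
  \<^typ>\<open>('a \<Rightarrow>\<^sub>0 nat) \<Rightarrow>\<^sub>0 real\<close> is the usual one, multiplication being convolution.
\<close>

type_synonym 'a real_mpoly = "('a \<Rightarrow>\<^sub>0 nat) \<Rightarrow>\<^sub>0 real"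

definition mpoly_const :: "real \<Rightarrow> 'a real_mpoly" where
  "mpoly_const c = Poly_Mapping.single 0 c"

definition mpoly_var :: "'a \<Rightarrow> 'a real_mpoly" where
  "mpoly_var i = Poly_Mapping.single (Poly_Mapping.single i 1) 1"

definition handelman_term :: "'a set \<Rightarrow> 'a set \<Rightarrow> 'a real_mpoly" where
  "handelman_term T I = (\<Prod>i\<in>I. mpoly_var i) * (\<Prod>i\<in>T - I. 1 - mpoly_var i)"

definition handelman_set :: "'a set \<Rightarrow> nat \<Rightarrow> 'a real_mpoly set" where
  "handelman_set V t =
     {(\<Sum>T | T \<subseteq> V \<and> card T \<le> t. \<Sum>I\<in>Pow T. mpoly_const (c T I) * handelman_term T I) | c.
        \<forall>T I. 0 \<le> c T I}"

text \<open>Edge weights are functions on edges, i.e. on two-element sets of vertices.\<close>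

definition stable_set_poly ::
    "'a set \<Rightarrow> 'a set set \<Rightarrow> ('a \<Rightarrow> real) \<Rightarrow> ('a set \<Rightarrow> real) \<Rightarrow> 'a real_mpoly" where
  "stable_set_poly V E w we =
     (\<Sum>i\<in>V. mpoly_const (w i) * mpoly_var i) - (\<Sum>e\<in>E. mpoly_const (we e) * (\<Prod>i\<in>e. mpoly_var i))"

text \<open>
  The bound lives in \<^typ>\<open>ereal\<close> because the set of feasible \<open>r\<close> can be empty for small \<open>t\<close>
  (infimum \<open>\<infinity>\<close>); similarly the rank is an \<^typ>\<open>enat\<close>, equal to \<open>\<infinity>\<close> if no order \<open>t\<close>
  is exact.
\<close>

definition handelman_bound ::
    "'a set \<Rightarrow> 'a set set \<Rightarrow> ('a \<Rightarrow> real) \<Rightarrow> ('a set \<Rightarrow> real) \<Rightarrow> nat \<Rightarrow> ereal" where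
  "handelman_bound V E w we t =
     (INF r \<in> {r. mpoly_const r - stable_set_poly V E w we \<in> handelman_set V t}. ereal r)"

definition handelman_rank ::
    "'a set \<Rightarrow> 'a set set \<Rightarrow> ('a \<Rightarrow> real) \<Rightarrow> ('a set \<Rightarrow> real) \<Rightarrow> enat" where
  "handelman_rank V E w we =
     (INF t \<in> {t. 1 \<le> t \<and> handelman_bound V E w we t = ereal (weighted_stability_number V E w)}.
        enat t)"

end

theory Submission
  imports Defs
begin

text \<open>
  For perfect graphs the weight \<open>w\<close> is a nonnegative combination of cliques, \<open>w = \<Sum> y\<^sub>K 1\<^sub>K\<close>, with
  \<open>\<Sum> y\<^sub>K = \<alpha>(G, w)\<close>. Since \<open>w\<^sub>i\<^sub>j \<ge> w\<^sub>i \<ge> \<Sum> {y\<^sub>K | i, j \<in> K}\<close>, the polynomial \<open>\<alpha>(G, w) - p\<close> is a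
  nonnegative combination of the edge monomials \<open>x\<^sub>i x\<^sub>j\<close> and of the clique polynomials
  \<open>1 - \<Sum>\<^sub>i x\<^sub>i + \<Sum>\<^sub>i\<^sub>j x\<^sub>i x\<^sub>j\<close>, where \<open>i\<close> and \<open>ij\<close> run over the vertices and edges of a clique \<open>K\<close>; the
  latter lie in the Handelman set of order \<open>card K\<close>.

  Conversely, the linear functional with \<open>1 \<mapsto> 1\<close>, \<open>x\<^sub>i \<mapsto> 1 / t\<close> and all higher products \<open>\<mapsto> 0\<close> is
  nonnegative on the Handelman set of order \<open>t\<close>, so the bound of order \<open>t\<close> is at least \<open>n / t\<close>. For
  vertex-transitive graphs \<open>\<alpha> \<omega> \<le> n\<close>, so the bound is not exact for \<open>t < \<omega>\<close>.
\<close>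

section \<open>Clique decompositions of weights on perfect graphs\<close>

lemma singleton_clique [simp]: "clique {v} E"
  and singleton_indep [simp]: "indep {v} E"
  by (auto simp: clique_def indep_def)

lemma card_clique_Int_indep_le_1:
  assumes "clique K E" "indep S E"
  shows "card (K \<inter> S) \<le> 1"
proof -
  have "u = v" if "u \<in> K \<inter> S" "v \<in> K \<inter> S" for u v
    using assms that unfolding clique_def indep_def by blast
  then show ?thesis
    by (metis One_nat_def card_le_Suc0_iff_eq card.infinite le0)
qed

lemma clique_induced_edges_iff: "K \<subseteq> U \<Longrightarrow> clique K (induced_edges E U) \<longleftrightarrow> clique K E"
  by (auto simp: clique_def induced_edges_def)

text \<open>Double counting of the pairs \<open>(v, i)\<close> with
  \<open>v \<in> C \<inter> F i\<close>: each stable \<open>F i\<close> contributes at most one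
  pair. Every \<open>F i\<close> that misses \<open>C\<close> lowers the bound below
  \<open>card I\<close>, and this gain is what both later uses exploit.\<close>

lemma sum_clique_le_card_indep:
  fixes x :: "'a \<Rightarrow> nat"
  assumes "finite C" "clique C E" "finite I" "\<And>i. i \<in> I \<Longrightarrow> indep (F i) E"
    and "\<And>v. v \<in> C \<Longrightarrow> x v \<le> card {i \<in> I. v \<in> F i}"
  shows "sum x C \<le> card {i \<in> I. C \<inter> F i \<noteq> {}}"
proof -
  have "sum x C \<le> (\<Sum>v\<in>C. card {i \<in> I. v \<in> F i})"
    using assms(5) by (rule sum_mono)
  also have "\<dots> = (\<Sum>i\<in>I. card {v \<in> C. v \<in> F i})"
    using sum_multicount_gen[OF assms(1,3), of "\<lambda>v i. v \<in> F i" "\<lambda>i. card {v \<in> C. v \<in> F i}"] by simp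
  also have "\<dots> = (\<Sum>i\<in>I. card (C \<inter> F i))"
    by (simp add: Int_def)
  also have "\<dots> \<le> (\<Sum>i\<in>I. if C \<inter> F i \<noteq> {} then 1 else 0)"
    using card_clique_Int_indep_le_1[OF assms(2)] assms(4) by (intro sum_mono) auto
  also have "\<dots> = card {i \<in> I. C \<inter> F i \<noteq> {}}"
    using assms(3) by (simp add: sum.If_cases Int_def)
  finally show ?thesis .
qed

section \<open>Finite graphs: extremal cliques, stable sets and colourings\<close>

context
  fixes V :: "'a set" and E :: "'a set set"
  assumes graph: "finite_simple_graph V E"
begin

lemma finite_vertices: "finite V"
  using graph by (simp add: finite_simple_graph_def)

lemma finite_edges: "finite E"
  using graph finite_imp_finite_nsets finite_subset unfolding finite_simple_graph_def by blast

lemma edge_subset: "e \<in> E \<Longrightarrow> e \<subseteq> V" and card_edge: "e \<in> E \<Longrightarrow> card e = 2"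
  using graph by (auto simp: finite_simple_graph_def nsets_def)

lemma card_clique_le_clique_number:
  assumes "U \<subseteq> V" "K \<subseteq> U" "clique K F"
  shows "card K \<le> clique_number U F"
  unfolding clique_number_def
  using assms finite_subset[OF assms(1) finite_vertices] by (intro Max_ge) auto

lemma clique_number_attained:
  assumes "U \<subseteq> V"
  obtains K where "K \<subseteq> U" "clique K F" "card K = clique_number U F"
proof -
  have "finite {card K | K. K \<subseteq> U \<and> clique K F}"
    using finite_subset[OF assms finite_vertices] by auto
  moreover have "{card K | K. K \<subseteq> U \<and> clique K F} \<noteq> {}"
    using null_clique by blast
  ultimately have "clique_number U F \<in> {card K | K. K \<subseteq> U \<and> clique K F}"
    unfolding clique_number_def by (rule Max_in)
  then show ?thesis using that by auto
qed

lemma sum_indep_le_weighted_stability_number: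
  "S \<subseteq> V \<Longrightarrow> indep S E \<Longrightarrow> sum w S \<le> weighted_stability_number V E w"
  unfolding weighted_stability_number_def using finite_vertices by (intro Max_ge) auto

lemma weighted_stability_number_attained:
  obtains S where "S \<subseteq> V" "indep S E" "sum w S = weighted_stability_number V E w"
proof -
  have "finite {sum w S | S. S \<subseteq> V \<and> indep S E}"
    using finite_vertices by auto
  moreover have "{sum w S | S. S \<subseteq> V \<and> indep S E} \<noteq> {}"
    using null_indep by blast
  ultimately have "weighted_stability_number V E w \<in> {sum w S | S. S \<subseteq> V \<and> indep S E}"
    unfolding weighted_stability_number_def by (rule Max_in)
  then show ?thesis using that by auto
qed

lemma chromatic_number_attained:
  assumes "U \<subseteq> V"
  shows "\<exists>f. proper_colouring U (induced_edges E U) (chromatic_number U (induced_edges E U)) f"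
proof -
  obtain f n where f: "f ` U = {i::nat. i < n}" "inj_on f U"
    using finite_imp_inj_to_nat_seg[OF finite_subset[OF assms finite_vertices]] by blast
  \<comment> \<open>\<open>card_edge\<close> rules out the loop \<open>{u, u}\<close>, so an
    injective numbering is a proper colouring.\<close>
  have "f u \<noteq> f v" if "u \<in> U" "v \<in> U" "{u, v} \<in> E" for u v
    using f(2) that card_edge[OF that(3)] by (auto simp: inj_on_def)
  then have "proper_colouring U (induced_edges E U) n f"
    using f(1) by (auto simp: proper_colouring_def induced_edges_def)
  then show ?thesis
    unfolding chromatic_number_def using LeastI_ex[of "\<lambda>k. \<exists>f. proper_colouring U (induced_edges E U) k f"] by blast
qed

section \<open>Perfect graphs: replication and clique decompositions\<close>

context
  assumes perfect: "perfect_graph V E"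
begin

text \<open>Perfection enters the argument here: on the subgraph induced by \<open>U\<close> the
  chromatic number is the size of a maximum clique, hence at most \<open>k\<close>, and spare
  colours do no harm.\<close>

lemma perfect_colouring:
  assumes "U \<subseteq> V" "\<And>C. C \<subseteq> U \<Longrightarrow> clique C E \<Longrightarrow> card C \<le> k"
  shows "\<exists>f. proper_colouring U (induced_edges E U) k f"
proof -
  let ?F = "induced_edges E U"
  obtain K where "K \<subseteq> U" "clique K ?F" "card K = clique_number U ?F"
    using clique_number_attained[OF assms(1)] .
  then have "chromatic_number U ?F \<le> k"
    using assms perfect by (metis clique_induced_edges_iff perfect_graph_def)
  moreover obtain f where "proper_colouring U ?F (chromatic_number U ?F) f"
    using chromatic_number_attained[OF assms(1)] by blast
  ultimately have "proper_colouring U ?F k f"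
    by (force simp: proper_colouring_def)
  then show ?thesis by blast
qed

text \<open>Lovasz's replication lemma, phrased with multiplicities instead of copies of vertices.\<close>

lemma stable_cover_of_multiplicities:
  fixes x :: "'a \<Rightarrow> nat"
  assumes "\<And>C. C \<subseteq> V \<Longrightarrow> clique C E \<Longrightarrow> sum x C \<le> k"
  shows "\<exists>F. (\<forall>i<k. F i \<subseteq> V \<and> indep (F i) E) \<and> (\<forall>v\<in>V. x v \<le> card {i. i < k \<and> v \<in> F i})"
  using assms
proof (induction "sum x V" arbitrary: x k rule: less_induct)
  case less
  show ?case
  proof (cases "\<forall>v\<in>V. x v \<le> 1")
    case True
    \<comment> \<open>\<open>x\<close> is the indicator of \<open>U\<close>, so the clique bound
      yields a \<open>k\<close>-colouring of \<open>U\<close>; its colour classes form the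
      cover.\<close>
    define U where "U = {v \<in> V. x v = 1}"
    have "U \<subseteq> V" by (auto simp: U_def)
    have "card C \<le> k" if "C \<subseteq> U" "clique C E" for C
    proof -
      have "card C = sum x C"
        using that(1) by (subst card_eq_sum, intro sum.cong) (auto simp: U_def)
      then show ?thesis using less.prems that \<open>U \<subseteq> V\<close> by auto
    qed
    then obtain f where f: "proper_colouring U (induced_edges E U) k f"
      using perfect_colouring[OF \<open>U \<subseteq> V\<close>] by blast
    define F where "F i = {v \<in> U. f v = i}" for i
    have "indep (F i) E" for i
      using f \<open>U \<subseteq> V\<close> by (fastforce simp: indep_def F_def proper_colouring_def induced_edges_def)
    moreover have "x v \<le> card {i. i < k \<and> v \<in> F i}" if "v \<in> V" for v
    proof (cases "x v = 1")
      case True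
      then have "{i. i < k \<and> v \<in> F i} = {f v}"
        using that f by (auto simp: F_def U_def proper_colouring_def)
      then show ?thesis using True by simp
    qed (use True that in \<open>auto simp: le_Suc_eq\<close>)
    ultimately show ?thesis
      using \<open>U \<subseteq> V\<close> by (intro exI[of _ F]) (auto simp: F_def)
  next
    case False
    then obtain v where v: "v \<in> V" "x v \<ge> 2" by force
    \<comment> \<open>One copy of \<open>v\<close> is dropped. As \<open>x v \<ge> 2\<close>,
      another copy remains, so some set \<open>F j\<close> of the cover for \<open>x'\<close>
      contains \<open>v\<close>.\<close>
    define x' where "x' = x(v := x v - 1)"
    have x'_le: "x' u \<le> x u" for u by (simp add: x'_def)
    have "sum x' V < sum x V"
      using v finite_vertices x'_le by (intro sum_strict_mono_ex1) (auto simp: x'_def)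
    moreover have "sum x' C \<le> k" if "C \<subseteq> V" "clique C E" for C
      using sum_mono[of C x' x] x'_le less.prems[OF that] by (meson order_trans)
    ultimately obtain F where F: "\<And>i. i < k \<Longrightarrow> F i \<subseteq> V" "\<And>i. i < k \<Longrightarrow> indep (F i) E"
      "\<And>u. u \<in> V \<Longrightarrow> x' u \<le> card {i. i < k \<and> u \<in> F i}"
      using less.hyps[of x' k] by blast
    have "x' v \<ge> 1" using v by (simp add: x'_def)
    then have "{i. i < k \<and> v \<in> F i} \<noteq> {}"
      using F(3)[OF v(1)] by (metis card.empty not_one_le_zero le_trans)
    then obtain j where j: "j < k" "v \<in> F j" by blast
    \<comment> \<open>The demand that is left once \<open>F j\<close> has been used; truncated
      subtraction keeps 0 at 0. It remains to cover it by \<open>k - 1\<close> sets.\<close>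
    define x'' where "x'' u = (if u \<in> F j then x u - 1 else x u)" for u
    have "sum x'' V < sum x V"
      using v j finite_vertices by (intro sum_strict_mono_ex1) (auto simp: x''_def intro!: bexI[of _ v])
    moreover have "sum x'' C \<le> k - 1" if C: "C \<subseteq> V" "clique C E" for C
    proof -
      define D where "D = {u \<in> C. x u > 0}"
      have D: "D \<subseteq> C" "D \<subseteq> V" "clique D E" "finite D" "finite C"
        using C smaller_clique[OF C(2), of D] finite_subset[OF _ finite_vertices]
        by (auto simp: D_def)
      have "sum x'' C = sum x'' D"
        using D by (intro sum.mono_neutral_right) (auto simp: D_def x''_def)
      also have "\<dots> \<le> k - 1"
      proof (cases "D \<inter> F j = {}")
        case True
        \<comment> \<open>Since \<open>v\<close> lies in \<open>F j\<close>, it is not in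
          \<open>D\<close>, so \<open>x''\<close> and \<open>x'\<close> agree on \<open>D\<close>;
          double counting then leaves only \<open>k - 1\<close> sets that can meet
          \<open>D\<close>.\<close>
        have "sum x'' D = sum x' D"
          using True j by (intro sum.cong) (auto simp: x''_def x'_def)
        also have "\<dots> \<le> card {i \<in> {..<k}. D \<inter> F i \<noteq> {}}"
          using D F by (intro sum_clique_le_card_indep[where E = E]) (auto simp: lessThan_def)
        also have "\<dots> \<le> card ({..<k} - {j})"
          using True by (intro card_mono) auto
        finally show ?thesis using j by simp
      next
        case False
        then obtain u where u: "u \<in> D" "u \<in> F j" by blast
        \<comment> \<open>Vertices of \<open>D\<close> have positive multiplicity, so
          \<open>u\<close> really loses a copy.\<close>
        have "sum x'' D < sum x D"
          using u D by (intro sum_strict_mono_ex1) (auto simp: x''_def D_def intro!: bexI[of _ u])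
        also have "\<dots> \<le> k" using less.prems D by blast
        finally show ?thesis by simp
      qed
      finally show ?thesis .
    qed
    ultimately obtain G where G: "\<And>i. i < k - 1 \<Longrightarrow> G i \<subseteq> V" "\<And>i. i < k - 1 \<Longrightarrow> indep (G i) E"
      "\<And>u. u \<in> V \<Longrightarrow> x'' u \<le> card {i. i < k - 1 \<and> u \<in> G i}"
      using less.hyps[of x'' "k - 1"] by blast
    \<comment> \<open>\<open>F j\<close> returns under the index \<open>k - 1\<close>, which the
      cover \<open>G\<close> leaves free.\<close>
    define H where "H = G(k - 1 := F j)"
    have "x u \<le> card {i. i < k \<and> u \<in> H i}" if "u \<in> V" for u
    proof -
      have eq: "{i. i < k \<and> u \<in> H i} = {i. i < k - 1 \<and> u \<in> G i} \<union> (if u \<in> F j then {k - 1} else {})"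
        using j by (auto simp: H_def less_diff_conv split: if_splits)
      have "card {i. i < k \<and> u \<in> H i} = card {i. i < k - 1 \<and> u \<in> G i} + (if u \<in> F j then 1 else 0)"
        unfolding eq by (subst card_Un_disjoint) auto
      then show ?thesis using G(3)[OF that] by (auto simp: x''_def split: if_splits)
    qed
    moreover have "H i \<subseteq> V \<and> indep (H i) E" if "i < k" for i
      using that j F(1,2)[of j] G(1,2)[of i] by (auto simp: H_def)
    ultimately show ?thesis by blast
  qed
qed

text \<open>Otherwise every clique is missed by some maximum weight stable set. If \<open>N\<close> cliques are considered,
  the \<open>N\<close> chosen stable sets cover the vertices with multiplicities \<open>x\<close> whose sum over any clique is at
  most \<open>N - 1\<close>; by replication \<open>N - 1\<close> stable sets suffice, too few to reach the total weight.\<close>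

lemma clique_meeting_all_maximum_stable_sets:
  fixes w :: "'a \<Rightarrow> real"
  assumes w: "\<And>v. v \<in> V \<Longrightarrow> 0 \<le> w v" and pos: "\<exists>v\<in>V. 0 < w v"
  shows "\<exists>K\<subseteq>V. clique K E \<and> (\<forall>v\<in>K. 0 < w v) \<and>
    (\<forall>S\<subseteq>V. indep S E \<longrightarrow> sum w S = weighted_stability_number V E w \<longrightarrow> K \<inter> S \<noteq> {})"
proof (rule ccontr)
  assume no_clique: "\<not> ?thesis"
  let ?\<alpha> = "weighted_stability_number V E w"
  define \<K> where "\<K> = {K. K \<subseteq> V \<and> clique K E \<and> (\<forall>v\<in>K. 0 < w v)}"
  have fin: "finite \<K>" using finite_vertices by (simp add: \<K>_def)
  have "\<exists>S. S \<subseteq> V \<and> indep S E \<and> sum w S = ?\<alpha> \<and> K \<inter> S = {}" if "K \<in> \<K>" for K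
  proof (rule ccontr)
    assume "\<not> ?thesis"
    then have "\<forall>S\<subseteq>V. indep S E \<longrightarrow> sum w S = ?\<alpha> \<longrightarrow> K \<inter> S \<noteq> {}" by simp
    moreover have "K \<subseteq> V" "clique K E" "\<forall>v\<in>K. 0 < w v" using that by (simp_all add: \<K>_def)
    ultimately have "K \<subseteq> V \<and> clique K E \<and> (\<forall>v\<in>K. 0 < w v) \<and>
      (\<forall>S\<subseteq>V. indep S E \<longrightarrow> sum w S = ?\<alpha> \<longrightarrow> K \<inter> S \<noteq> {})" by simp
    with no_clique show False by (elim notE) (rule exI)
  qed
  then have "\<forall>K\<in>\<K>. \<exists>S. S \<subseteq> V \<and> indep S E \<and> sum w S = ?\<alpha> \<and> K \<inter> S = {}" by simp
  from bchoice[OF this] obtain \<sigma> where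
    "\<forall>K\<in>\<K>. \<sigma> K \<subseteq> V \<and> indep (\<sigma> K) E \<and> sum w (\<sigma> K) = ?\<alpha> \<and> K \<inter> \<sigma> K = {}" ..
  then have \<sigma>: "\<And>K. K \<in> \<K> \<Longrightarrow> \<sigma> K \<subseteq> V" "\<And>K. K \<in> \<K> \<Longrightarrow> indep (\<sigma> K) E"
    "\<And>K. K \<in> \<K> \<Longrightarrow> sum w (\<sigma> K) = ?\<alpha>" "\<And>K. K \<in> \<K> \<Longrightarrow> K \<inter> \<sigma> K = {}"
    by simp_all
  define x where "x v = (if 0 < w v then card {K \<in> \<K>. v \<in> \<sigma> K} else 0)" for v
  have "sum x C \<le> card \<K> - 1" if C: "C \<subseteq> V" "clique C E" for C
  proof -
    \<comment> \<open>\<open>D\<close> itself belongs to \<open>\<K>\<close> and is missed by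
      \<open>\<sigma> D\<close>, so at most \<open>card \<K> - 1\<close> of the chosen stable sets
      meet it.\<close>
    define D where "D = {v \<in> C. 0 < w v}"
    have D: "D \<in> \<K>" "finite D" "finite C" "clique D E" "D \<subseteq> C"
      using C smaller_clique[OF C(2), of D] finite_subset[OF _ finite_vertices]
      by (auto simp: D_def \<K>_def)
    have "sum x C = sum x D"
      using D by (intro sum.mono_neutral_right) (auto simp: D_def x_def)
    also have "\<dots> \<le> card {K \<in> \<K>. D \<inter> \<sigma> K \<noteq> {}}"
      using D \<sigma> fin by (intro sum_clique_le_card_indep[where E = E]) (auto simp: x_def)
    also have "\<dots> \<le> card (\<K> - {D})"
      using \<sigma>(4)[OF D(1)] fin by (intro card_mono) auto
    finally show ?thesis using D(1) fin by simp
  qed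
  then obtain F where F: "\<And>i. i < card \<K> - 1 \<Longrightarrow> F i \<subseteq> V" "\<And>i. i < card \<K> - 1 \<Longrightarrow> indep (F i) E"
    "\<And>u. u \<in> V \<Longrightarrow> x u \<le> card {i. i < card \<K> - 1 \<and> u \<in> F i}"
    using stable_cover_of_multiplicities[of x "card \<K> - 1"] by blast
  \<comment> \<open>The index type is general because the identity serves both for the cliques in
    \<open>\<K>\<close> and for the numbers below \<open>card \<K> - 1\<close>.\<close>
  have count: "(\<Sum>v\<in>V. w v * card {i \<in> I. v \<in> T i}) = (\<Sum>i\<in>I. sum w (T i))"
    if "finite I" "\<And>i. i \<in> I \<Longrightarrow> T i \<subseteq> V" for I :: "'b set" and T
  proof -
    have "(\<Sum>v\<in>V. w v * card {i \<in> I. v \<in> T i}) = (\<Sum>v\<in>V. \<Sum>i | i \<in> I \<and> v \<in> T i. w v)"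
      by (simp add: mult.commute)
    also have "\<dots> = (\<Sum>i\<in>I. \<Sum>v | v \<in> V \<and> v \<in> T i. w v)"
      using finite_vertices that(1) by (rule sum.swap_restrict)
    also have "\<dots> = (\<Sum>i\<in>I. sum w (T i))"
      using that(2) by (intro sum.cong) auto
    finally show ?thesis .
  qed
  have "card \<K> * ?\<alpha> = (\<Sum>K\<in>\<K>. sum w (\<sigma> K))"
    using \<sigma>(3) by simp
  also have "\<dots> = (\<Sum>v\<in>V. w v * card {K \<in> \<K>. v \<in> \<sigma> K})"
    using count[OF fin] \<sigma>(1) by simp
  also have "\<dots> \<le> (\<Sum>v\<in>V. w v * card {i \<in> {..<card \<K> - 1}. v \<in> F i})"
  proof (intro sum_mono)
    fix v assume v: "v \<in> V"
    show "w v * card {K \<in> \<K>. v \<in> \<sigma> K} \<le> w v * card {i \<in> {..<card \<K> - 1}. v \<in> F i}"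
    proof (cases "0 < w v")
      case True
      then show ?thesis using F(3)[OF v] by (simp add: x_def lessThan_def)
    qed (use w[OF v] in auto)
  qed
  also have "\<dots> = (\<Sum>i<card \<K> - 1. sum w (F i))"
    using F(1) by (intro count) auto
  also have "\<dots> \<le> (\<Sum>i<card \<K> - 1. ?\<alpha>)"
    using F by (intro sum_mono sum_indep_le_weighted_stability_number) auto
  finally have le: "card \<K> * ?\<alpha> \<le> (card \<K> - 1) * ?\<alpha>" by simp
  \<comment> \<open>The empty clique makes \<open>\<K>\<close> nonempty, so
    \<open>card \<K> - 1\<close> is a true predecessor and the inequality forces
    \<open>?\<alpha> \<le> 0\<close>.\<close>
  have "{} \<in> \<K>" by (simp add: \<K>_def)
  then have "card \<K> > 0" using fin card_gt_0_iff by blast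
  then have "?\<alpha> \<le> 0" using le by (simp add: of_nat_diff algebra_simps)
  moreover obtain v where "v \<in> V" "0 < w v" using pos by blast
  moreover have "w v \<le> ?\<alpha>"
    using sum_indep_le_weighted_stability_number[of "{v}" w] \<open>v \<in> V\<close> by simp
  ultimately show False by simp
qed

text \<open>Subtract from \<open>w\<close> the largest multiple \<open>\<epsilon>\<close> of the indicator of such a clique \<open>K\<close> that keeps \<open>w\<close>
  nonnegative and lowers the weighted stability number by \<open>\<epsilon>\<close>. Maximum weight stable sets stay so, and
  either the support of \<open>w\<close> shrinks or another stable set attains the maximum.\<close>

lemma clique_decomposition:
  fixes w :: "'a \<Rightarrow> real"
  assumes "\<And>v. v \<in> V \<Longrightarrow> 0 \<le> w v"
  shows "\<exists>y. (\<forall>K. 0 \<le> y K) \<and> (\<forall>K\<subseteq>V. y K \<noteq> 0 \<longrightarrow> clique K E) \<and>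
    (\<forall>v\<in>V. w v = (\<Sum>K | K \<subseteq> V \<and> v \<in> K. y K)) \<and>
    weighted_stability_number V E w = (\<Sum>K\<in>Pow V. y K)"
  using assms
proof (induction "card {v \<in> V. 0 < w v} +
    card {S. S \<subseteq> V \<and> indep S E \<and> sum w S \<noteq> weighted_stability_number V E w}"
    arbitrary: w rule: less_induct)
  case less
  let ?\<alpha> = "weighted_stability_number V E"
  show ?case
  proof (cases "\<exists>v\<in>V. 0 < w v")
    case False
    then have w0: "w v = 0" if "v \<in> V" for v using less.prems[OF that] that by force
    obtain S where "S \<subseteq> V" "sum w S = ?\<alpha> w" using weighted_stability_number_attained .
    then have "?\<alpha> w = 0" using w0 by (metis subsetD sum.neutral)
    then show ?thesis using w0 by (intro exI[of _ "\<lambda>_. 0"]) auto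
  next
    case True
    obtain K where K: "K \<subseteq> V" "clique K E" "\<And>v. v \<in> K \<Longrightarrow> 0 < w v"
      and meets: "\<And>S. S \<subseteq> V \<Longrightarrow> indep S E \<Longrightarrow> sum w S = ?\<alpha> w \<Longrightarrow> K \<inter> S \<noteq> {}"
      using clique_meeting_all_maximum_stable_sets[of w] less.prems True by blast
    have "finite K" using K(1) finite_vertices finite_subset by blast
    \<comment> \<open>The upper bounds on \<open>\<epsilon>\<close>: weights on \<open>K\<close>
      must stay nonnegative, and a stable set missing \<open>K\<close>, whose weight does not
      change, must not exceed \<open>?\<alpha> w - \<epsilon>\<close>.\<close>
    define D where "D = w ` K \<union> (\<lambda>S. ?\<alpha> w - sum w S) ` {S. S \<subseteq> V \<and> indep S E \<and> K \<inter> S = {}}"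
    have "finite D" using finite_vertices \<open>finite K\<close> by (auto simp: D_def)
    have "{} \<in> {S. S \<subseteq> V \<and> indep S E \<and> K \<inter> S = {}}" by simp
    then have "D \<noteq> {}" unfolding D_def by blast
    define \<epsilon> where "\<epsilon> = Min D"
    have "\<epsilon> \<in> D" and \<epsilon>_le: "\<And>d. d \<in> D \<Longrightarrow> \<epsilon> \<le> d"
      using \<open>finite D\<close> \<open>D \<noteq> {}\<close> by (auto simp: \<epsilon>_def)
    have "0 < ?\<alpha> w - sum w S" if "S \<subseteq> V" "indep S E" "K \<inter> S = {}" for S
      using meets[OF that(1,2)] sum_indep_le_weighted_stability_number[OF that(1,2), of w] that(3)
      by linarith
    then have "0 < \<epsilon>" using \<open>\<epsilon> \<in> D\<close> K(3) by (auto simp: D_def)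
    define w' where "w' v = (if v \<in> K then w v - \<epsilon> else w v)" for v
    have w'_nonneg: "0 \<le> w' v" if "v \<in> V" for v
      using less.prems[OF that] \<epsilon>_le[of "w v"] by (auto simp: w'_def D_def)
    have sum_w': "sum w' S = sum w S - \<epsilon> * card (K \<inter> S)" if "S \<subseteq> V" for S
    proof -
      have "finite S" using that finite_vertices finite_subset by blast
      have "sum w' S = (\<Sum>v\<in>S. w v - (if v \<in> K then \<epsilon> else 0))"
        by (intro sum.cong) (auto simp: w'_def)
      also have "\<dots> = sum w S - \<epsilon> * card (K \<inter> S)"
        using \<open>finite S\<close> by (simp add: sum_subtractf sum.If_cases Int_def conj_commute)
      finally show ?thesis .
    qed
    have tight: "sum w' S = ?\<alpha> w - \<epsilon>" if "S \<subseteq> V" "indep S E" "sum w S = ?\<alpha> w" for S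
    proof -
      have "card (K \<inter> S) = 1"
        using meets[OF that] card_clique_Int_indep_le_1[OF K(2) that(2)] \<open>finite K\<close>
        by (simp add: le_Suc_eq)
      then show ?thesis using sum_w'[OF that(1)] that by simp
    qed
    have \<alpha>_w': "?\<alpha> w' = ?\<alpha> w - \<epsilon>"
    proof (rule antisym)
      obtain S where S: "S \<subseteq> V" "indep S E" "sum w' S = ?\<alpha> w'"
        using weighted_stability_number_attained .
      \<comment> \<open>A stable set missing \<open>K\<close> is controlled by the choice of
        \<open>\<epsilon>\<close>; any other one loses at least \<open>\<epsilon>\<close>.\<close>
      show "?\<alpha> w' \<le> ?\<alpha> w - \<epsilon>"
      proof (cases "K \<inter> S = {}")
        case True
        then show ?thesis using \<epsilon>_le[of "?\<alpha> w - sum w S"] sum_w'[OF S(1)] S by (auto simp: D_def)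
      next
        case False
        then have "1 \<le> card (K \<inter> S)" using \<open>finite K\<close> by (simp add: Suc_le_eq card_gt_0_iff)
        then have "\<epsilon> \<le> \<epsilon> * card (K \<inter> S)" using \<open>0 < \<epsilon>\<close> by simp
        then show ?thesis
          using sum_w'[OF S(1)] S sum_indep_le_weighted_stability_number[OF S(1,2), of w] by simp
      qed
      obtain S where "S \<subseteq> V" "indep S E" "sum w S = ?\<alpha> w"
        using weighted_stability_number_attained .
      then show "?\<alpha> w - \<epsilon> \<le> ?\<alpha> w'"
        using tight sum_indep_le_weighted_stability_number[of S w'] by simp
    qed
    let ?P = "\<lambda>w. {v \<in> V. 0 < w v}" and ?N = "\<lambda>w. {S. S \<subseteq> V \<and> indep S E \<and> sum w S \<noteq> ?\<alpha> w}"
    have P: "?P w' \<subseteq> ?P w" using \<open>0 < \<epsilon>\<close> by (auto simp: w'_def split: if_splits)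
    have N: "?N w' \<subseteq> ?N w" using tight \<alpha>_w' by auto
    have "?P w' \<noteq> ?P w \<or> ?N w' \<noteq> ?N w"
      using \<open>\<epsilon> \<in> D\<close> unfolding D_def
    proof
      assume "\<epsilon> \<in> w ` K"
      then obtain v where "v \<in> K" "\<epsilon> = w v" by blast
      then have "v \<in> ?P w" "v \<notin> ?P w'" using K by (auto simp: w'_def)
      then show ?thesis by blast
    next
      assume "\<epsilon> \<in> (\<lambda>S. ?\<alpha> w - sum w S) ` {S. S \<subseteq> V \<and> indep S E \<and> K \<inter> S = {}}"
      then obtain S where S: "\<epsilon> = ?\<alpha> w - sum w S" "S \<subseteq> V" "indep S E" "K \<inter> S = {}" by blast
      \<comment> \<open>\<open>S\<close> misses \<open>K\<close>, so it keeps its weight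
        \<open>?\<alpha> w - \<epsilon>\<close>, which is the new maximum.\<close>
      then have "S \<in> ?N w" "S \<notin> ?N w'" using \<alpha>_w' sum_w'[OF S(2)] \<open>0 < \<epsilon>\<close> by auto
      then show ?thesis by blast
    qed
    moreover have "finite (?P w)" "finite (?N w)" using finite_vertices by auto
    ultimately have "card (?P w') + card (?N w') < card (?P w) + card (?N w)"
      using P N by (meson add_le_less_mono add_less_le_mono card_mono psubsetI psubset_card_mono)
    from less.hyps[OF this w'_nonneg]
    obtain y where y: "\<And>L. 0 \<le> y L" "\<And>L. L \<subseteq> V \<Longrightarrow> y L \<noteq> 0 \<Longrightarrow> clique L E"
      "\<And>v. v \<in> V \<Longrightarrow> w' v = (\<Sum>L | L \<subseteq> V \<and> v \<in> L. y L)" "?\<alpha> w' = (\<Sum>L\<in>Pow V. y L)"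
      by blast
    define z where "z L = y L + (if L = K then \<epsilon> else 0)" for L
    have "w v = (\<Sum>L | L \<subseteq> V \<and> v \<in> L. z L)" if "v \<in> V" for v
    proof -
      have "(\<Sum>L | L \<subseteq> V \<and> v \<in> L. z L) = w' v + (if v \<in> K then \<epsilon> else 0)"
        using y(3)[OF that] K(1) finite_vertices by (simp add: z_def sum.distrib)
      then show ?thesis by (simp add: w'_def)
    qed
    moreover have "?\<alpha> w = (\<Sum>L\<in>Pow V. z L)"
      using y(4) \<alpha>_w' K(1) finite_vertices by (simp add: z_def sum.distrib)
    moreover have "0 \<le> z L" for L using y(1)[of L] \<open>0 < \<epsilon>\<close> by (simp add: z_def)
    moreover have "clique L E" if "L \<subseteq> V" "z L \<noteq> 0" for L
      using y(2)[OF that(1)] that(2) K(2) by (auto simp: z_def split: if_splits)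
    ultimately show ?thesis by blast
  qed
qed

end

end

section \<open>Evaluation at indicator vectors\<close>

text \<open>The value of \<open>f\<close> at the 0/1 vector of \<open>S\<close>: there a monomial is
  1 or 0 according to whether all its variables lie in \<open>S\<close>, whatever the
  exponents.\<close>

definition eval_indicator :: "'a set \<Rightarrow> 'a real_mpoly \<Rightarrow> real" where
  "eval_indicator S f =
    (\<Sum>m\<in>Poly_Mapping.keys f. poly_mapping.lookup f m * of_bool (Poly_Mapping.keys m \<subseteq> S))"

lemma eval_indicator_superset:
  assumes "finite M" "Poly_Mapping.keys f \<subseteq> M"
  shows "eval_indicator S f =
    (\<Sum>m\<in>M. poly_mapping.lookup f m * of_bool (Poly_Mapping.keys m \<subseteq> S))"
  unfolding eval_indicator_def
  using assms by (intro sum.mono_neutral_left) (auto simp: in_keys_iff)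

lemma eval_indicator_add [simp]: "eval_indicator S (f + g) = eval_indicator S f + eval_indicator S g"
  using eval_indicator_superset[of "Poly_Mapping.keys f \<union> Poly_Mapping.keys g" "f + g" S]
    eval_indicator_superset[of "Poly_Mapping.keys f \<union> Poly_Mapping.keys g" f S]
    eval_indicator_superset[of "Poly_Mapping.keys f \<union> Poly_Mapping.keys g" g S] keys_add[of f g]
  by (simp add: lookup_add distrib_right sum.distrib)

lemma eval_indicator_uminus [simp]: "eval_indicator S (- f) = - eval_indicator S f"
  by (simp add: eval_indicator_def sum_negf)

lemma eval_indicator_diff [simp]: "eval_indicator S (f - g) = eval_indicator S f - eval_indicator S g"
  using eval_indicator_add[of S f "- g"] by simp

lemma eval_indicator_single [simp]:
  "eval_indicator S (Poly_Mapping.single m c) = c * of_bool (Poly_Mapping.keys m \<subseteq> S)"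
  by (simp add: eval_indicator_def)

lemma eval_indicator_0 [simp]: "eval_indicator S 0 = 0"
  by (simp add: eval_indicator_def)

lemma eval_indicator_1 [simp]: "eval_indicator S 1 = 1"
  using eval_indicator_single[of S 0 1] by simp

lemma eval_indicator_sum [simp]: "eval_indicator S (sum f A) = (\<Sum>i\<in>A. eval_indicator S (f i))"
  by (induction A rule: infinite_finite_induct) auto

lemma sum_single_lookup:
  "(\<Sum>m\<in>Poly_Mapping.keys f. Poly_Mapping.single m (poly_mapping.lookup f m)) = f"
  by (intro poly_mapping_eqI) (simp add: lookup_sum lookup_single when_def in_keys_iff)

text \<open>Natural exponents cannot cancel; this is what makes evaluation multiplicative.\<close>

lemma keys_add_nat:
  fixes m n :: "'a \<Rightarrow>\<^sub>0 nat"
  shows "Poly_Mapping.keys (m + n) = Poly_Mapping.keys m \<union> Poly_Mapping.keys n"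
  by (auto simp: in_keys_iff lookup_add)

lemma eval_indicator_mult [simp]: "eval_indicator S (f * g) = eval_indicator S f * eval_indicator S g"
proof -
  have "f * g = (\<Sum>m\<in>Poly_Mapping.keys f. \<Sum>n\<in>Poly_Mapping.keys g.
      Poly_Mapping.single (m + n) (poly_mapping.lookup f m * poly_mapping.lookup g n))"
    by (subst (1 2) sum_single_lookup[symmetric]) (simp add: sum_product mult_single)
  then have "eval_indicator S (f * g) =
      (\<Sum>m\<in>Poly_Mapping.keys f. \<Sum>n\<in>Poly_Mapping.keys g.
        poly_mapping.lookup f m * poly_mapping.lookup g n * of_bool (Poly_Mapping.keys (m + n) \<subseteq> S))"
    by simp
  also have "\<dots> = eval_indicator S f * eval_indicator S g"
    by (simp only: eval_indicator_def sum_product keys_add_nat Un_subset_iff of_bool_conj mult_ac)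
  finally show ?thesis .
qed

lemma eval_indicator_prod [simp]: "eval_indicator S (prod f A) = (\<Prod>i\<in>A. eval_indicator S (f i))"
  by (induction A rule: infinite_finite_induct) auto

lemma eval_indicator_const [simp]: "eval_indicator S (mpoly_const c) = c"
  by (simp add: mpoly_const_def)

lemma eval_indicator_var [simp]: "eval_indicator S (mpoly_var i) = of_bool (i \<in> S)"
  by (simp add: mpoly_var_def)

lemma prod_of_bool: "finite A \<Longrightarrow> (\<Prod>i\<in>A. of_bool (P i) :: real) = of_bool (\<forall>i\<in>A. P i)"
  by (induction A rule: finite_induct) auto

text \<open>Each factor is 0 or 1 at such a point, and all are 1 exactly if
  \<open>I \<subseteq> S\<close> and \<open>T - I\<close> is disjoint from \<open>S\<close>.\<close>

lemma eval_indicator_handelman_term: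
  assumes "finite T" "I \<subseteq> T"
  shows "eval_indicator S (handelman_term T I) = of_bool (T \<inter> S = I)"
proof -
  have "finite I" "finite (T - I)" using assms finite_subset by auto
  moreover have "1 - of_bool (i \<in> S) = (of_bool (i \<notin> S) :: real)" for i by simp
  ultimately have "eval_indicator S (handelman_term T I) =
      of_bool (\<forall>i\<in>I. i \<in> S) * of_bool (\<forall>i\<in>T - I. i \<notin> S)"
    by (simp only: handelman_term_def eval_indicator_mult eval_indicator_prod eval_indicator_diff
        eval_indicator_1 eval_indicator_var prod_of_bool)
  also have "\<dots> = of_bool (T \<inter> S = I)" using assms(2) by auto
  finally show ?thesis .
qed

section \<open>The Handelman set\<close>

lemma mpoly_const_0 [simp]: "mpoly_const 0 = 0"
  and mpoly_const_1 [simp]: "mpoly_const 1 = 1"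
  by (simp_all add: mpoly_const_def)

lemma mpoly_const_add: "mpoly_const (c + d) = mpoly_const c + mpoly_const d"
  by (simp add: mpoly_const_def single_add)

lemma mpoly_const_diff: "mpoly_const (c - d) = mpoly_const c - mpoly_const d"
  by (simp add: mpoly_const_def single_diff)

lemma mpoly_const_mult: "mpoly_const (c * d) = mpoly_const c * mpoly_const d"
  by (simp add: mpoly_const_def mult_single)

lemma mpoly_const_sum: "mpoly_const (sum f A) = (\<Sum>i\<in>A. mpoly_const (f i))"
  by (induction A rule: infinite_finite_induct) (simp_all add: mpoly_const_add)

lemma handelman_setI:
  assumes "\<And>T I. 0 \<le> c T I"
  shows "(\<Sum>T | T \<subseteq> V \<and> card T \<le> t. \<Sum>I\<in>Pow T. mpoly_const (c T I) * handelman_term T I)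
    \<in> handelman_set V t"
  unfolding handelman_set_def using assms by blast

lemma zero_in_handelman_set: "0 \<in> handelman_set V t"
  using handelman_setI[of "\<lambda>_ _. 0" V t] by simp

lemma handelman_set_add:
  assumes "f \<in> handelman_set V t" "g \<in> handelman_set V t"
  shows "f + g \<in> handelman_set V t"
proof -
  obtain c where c: "\<And>T I. 0 \<le> c T I" "f = (\<Sum>T | T \<subseteq> V \<and> card T \<le> t.
      \<Sum>I\<in>Pow T. mpoly_const (c T I) * handelman_term T I)"
    using assms(1) unfolding handelman_set_def by auto
  obtain d where d: "\<And>T I. 0 \<le> d T I" "g = (\<Sum>T | T \<subseteq> V \<and> card T \<le> t.
      \<Sum>I\<in>Pow T. mpoly_const (d T I) * handelman_term T I)"
    using assms(2) unfolding handelman_set_def by auto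
  show ?thesis
    using handelman_setI[of "\<lambda>T I. c T I + d T I" V t] c d
    by (simp add: mpoly_const_add distrib_right sum.distrib)
qed

lemma handelman_set_sum:
  "(\<And>i. i \<in> A \<Longrightarrow> f i \<in> handelman_set V t) \<Longrightarrow> sum f A \<in> handelman_set V t"
  by (induction A rule: infinite_finite_induct) (auto simp: zero_in_handelman_set handelman_set_add)

lemma handelman_term_in_handelman_set:
  assumes "finite V" "T \<subseteq> V" "card T \<le> t" "I \<subseteq> T" "0 \<le> c"
  shows "mpoly_const c * handelman_term T I \<in> handelman_set V t"
proof -
  define d where "d = (\<lambda>T' I'. if T' = T then if I' = I then c else 0 else 0)"
  have fin: "finite {T. T \<subseteq> V \<and> card T \<le> t}" "finite (Pow T)"
    using assms(1,2) finite_subset[OF assms(2,1)] by auto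
  have "(\<Sum>T' | T' \<subseteq> V \<and> card T' \<le> t. \<Sum>I'\<in>Pow T'. mpoly_const (d T' I') * handelman_term T' I')
      = (\<Sum>T' | T' \<subseteq> V \<and> card T' \<le> t. if T' = T then
          (\<Sum>I'\<in>Pow T. if I' = I then mpoly_const c * handelman_term T I else 0) else 0)"
    by (intro sum.cong refl) (auto simp: d_def intro!: sum.cong)
  also have "\<dots> = mpoly_const c * handelman_term T I"
    using assms fin by simp
  finally show ?thesis
    using handelman_setI[of d V t] assms(5) by (simp add: d_def)
qed

lemma handelman_set_scale:
  assumes "f \<in> handelman_set V t" "0 \<le> a"
  shows "mpoly_const a * f \<in> handelman_set V t"
proof -
  obtain c where c: "\<And>T I. 0 \<le> c T I" "f = (\<Sum>T | T \<subseteq> V \<and> card T \<le> t.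
      \<Sum>I\<in>Pow T. mpoly_const (c T I) * handelman_term T I)"
    using assms(1) unfolding handelman_set_def by auto
  then show ?thesis
    using handelman_setI[of "\<lambda>T I. a * c T I" V t] assms(2)
    by (simp add: mpoly_const_mult sum_distrib_left mult.assoc)
qed

text \<open>Multiply by the product of \<open>mpoly_var i + (1 - mpoly_var i)\<close> over
  \<open>K - J\<close>, which is 1, and expand; \<open>B\<close> collects the indices where the
  variable was taken. With \<open>J\<close> of size 0, 1 and 2 this writes every part of a clique
  polynomial in terms over the same \<open>K\<close>.\<close>

lemma prod_var_eq_sum_handelman_term:
  assumes "finite K" "J \<subseteq> K"
  shows "(\<Prod>i\<in>J. mpoly_var i) =
    (\<Sum>I\<in>Pow K. mpoly_const (of_bool (J \<subseteq> I)) * handelman_term K I)"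
proof -
  have fin: "finite J" "finite (K - J)" using assms finite_subset by auto
  have "(\<Prod>i\<in>J. mpoly_var i) = (\<Prod>i\<in>J. mpoly_var i) * (\<Prod>i\<in>K - J. mpoly_var i + (1 - mpoly_var i))"
    by simp
  also have "\<dots> = (\<Sum>B\<in>Pow (K - J). (\<Prod>i\<in>J. mpoly_var i) *
      ((\<Prod>i\<in>B. mpoly_var i) * (\<Prod>i\<in>K - J - B. 1 - mpoly_var i)))"
    unfolding prod_add[OF fin(2)] by (simp add: sum_distrib_left)
  also have "\<dots> = (\<Sum>B\<in>Pow (K - J). handelman_term K (J \<union> B))"
  proof (intro sum.cong refl)
    fix B assume "B \<in> Pow (K - J)"
    then have "finite B" "J \<inter> B = {}" "K - J - B = K - (J \<union> B)" using fin finite_subset by auto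
    then show "(\<Prod>i\<in>J. mpoly_var i) * ((\<Prod>i\<in>B. mpoly_var i) * (\<Prod>i\<in>K - J - B. 1 - mpoly_var i)) =
        handelman_term K (J \<union> B)"
      using fin by (simp add: handelman_term_def prod.union_disjoint mult.assoc)
  qed
  also have "\<dots> = (\<Sum>I\<in>{I \<in> Pow K. J \<subseteq> I}. handelman_term K I)"
    using assms by (intro sum.reindex_bij_witness[of _ "\<lambda>I. I - J" "\<lambda>B. J \<union> B"]) auto
  also have "\<dots> = (\<Sum>I\<in>Pow K. mpoly_const (of_bool (J \<subseteq> I)) * handelman_term K I)"
    using assms(1) by (subst sum.inter_filter) (auto intro!: sum.cong)
  finally show ?thesis .
qed

text \<open>The coefficient of \<open>handelman_term K I\<close> is the value \<open>(k - 1) (k - 2) / 2\<close>, with \<open>k = card I\<close>, of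
  the polynomial at the indicator vector of \<open>I\<close>.\<close>

lemma clique_poly_in_handelman_set:
  assumes "finite V" "K \<subseteq> V" "card K \<le> t"
  shows "1 - (\<Sum>i\<in>K. mpoly_var i) + (\<Sum>e\<in>[K]\<^bsup>2\<^esup>. \<Prod>i\<in>e. mpoly_var i) \<in> handelman_set V t"
proof -
  have K: "finite K" using assms finite_subset by blast
  let ?c = "\<lambda>I. 1 - (\<Sum>i\<in>K. of_bool (i \<in> I)) + (\<Sum>e\<in>[K]\<^bsup>2\<^esup>. of_bool (e \<subseteq> I)) :: real"
  have 1: "1 = (\<Sum>I\<in>Pow K. mpoly_const 1 * handelman_term K I)"
    using prod_var_eq_sum_handelman_term[OF K, of "{}"] by simp
  have 2: "mpoly_var i = (\<Sum>I\<in>Pow K. mpoly_const (of_bool (i \<in> I)) * handelman_term K I)"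
    if "i \<in> K" for i
    using prod_var_eq_sum_handelman_term[OF K, of "{i}"] that by simp
  have 3: "(\<Prod>i\<in>e. mpoly_var i) = (\<Sum>I\<in>Pow K. mpoly_const (of_bool (e \<subseteq> I)) * handelman_term K I)"
    if "e \<in> [K]\<^bsup>2\<^esup>" for e
    using prod_var_eq_sum_handelman_term[OF K, of e] that by (simp add: nsets_def)
  have "1 - (\<Sum>i\<in>K. mpoly_var i) + (\<Sum>e\<in>[K]\<^bsup>2\<^esup>. \<Prod>i\<in>e. mpoly_var i) =
      (\<Sum>I\<in>Pow K. mpoly_const 1 * handelman_term K I) -
      (\<Sum>i\<in>K. \<Sum>I\<in>Pow K. mpoly_const (of_bool (i \<in> I)) * handelman_term K I) +
      (\<Sum>e\<in>[K]\<^bsup>2\<^esup>. \<Sum>I\<in>Pow K. mpoly_const (of_bool (e \<subseteq> I)) * handelman_term K I)"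
    using 1 2 3 by (intro arg_cong2[where f = "(+)"] arg_cong2[where f = "(-)"] sum.cong) auto
  also have "\<dots> = (\<Sum>I\<in>Pow K. mpoly_const (?c I) * handelman_term K I)"
    by (subst (1 2) sum.swap)
      (simp only: mpoly_const_add mpoly_const_diff mpoly_const_sum sum.distrib sum_subtractf
        sum_distrib_right distrib_right left_diff_distrib)
  also have "\<dots> \<in> handelman_set V t"
  proof (intro handelman_set_sum handelman_term_in_handelman_set[OF assms])
    fix I assume I: "I \<in> Pow K"
    then have "finite I" using K finite_subset by blast
    have "(\<Sum>i\<in>K. of_bool (i \<in> I) :: real) = card I"
      using I K by (simp add: of_bool_def sum.If_cases Int_absorb1)
    moreover have "{e \<in> [K]\<^bsup>2\<^esup>. e \<subseteq> I} = [I]\<^bsup>2\<^esup>" using I by (auto simp: nsets_def)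
    then have "(\<Sum>e\<in>[K]\<^bsup>2\<^esup>. of_bool (e \<subseteq> I) :: real) = card I choose 2"
      using finite_imp_finite_nsets[OF K, of 2] by (simp add: of_bool_def sum.If_cases Int_def)
    \<comment> \<open>Pascal's rule: \<open>Suc m choose 2\<close> is
      \<open>m + (m choose 2)\<close>, hence at least \<open>m\<close>.\<close>
    moreover have "n \<le> 1 + (n choose 2)" for n :: nat
    proof (cases n)
      case (Suc m)
      then show ?thesis using binomial_Suc_Suc[of m 1] by (simp add: numeral_2_eq_2)
    qed simp
    then have "real (card I) \<le> 1 + real (card I choose 2)"
      by (metis of_nat_1 of_nat_add of_nat_le_iff)
    ultimately show "0 \<le> ?c I" by simp
  qed auto
  finally show ?thesis .
qed

section \<open>Evaluation functionals and their signs on the Handelman set\<close>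

lemma eval_indicator_stable_set_poly:
  assumes "finite V" "\<And>e. e \<in> E \<Longrightarrow> finite e" "finite E"
  shows "eval_indicator S (stable_set_poly V E w we) = sum w (V \<inter> S) - sum we {e \<in> E. e \<subseteq> S}"
proof -
  have "eval_indicator S (stable_set_poly V E w we) =
      (\<Sum>i\<in>V. w i * of_bool (i \<in> S)) - (\<Sum>e\<in>E. we e * of_bool (e \<subseteq> S))"
    unfolding stable_set_poly_def using assms(2)
    by (auto simp: prod_of_bool subset_iff intro!: arg_cong2[where f = "(-)"] sum.cong)
  also have "(\<Sum>i\<in>V. w i * of_bool (i \<in> S)) = (\<Sum>i\<in>V. if i \<in> S then w i else 0)"
    by (intro sum.cong) auto
  also have "(\<Sum>e\<in>E. we e * of_bool (e \<subseteq> S)) = (\<Sum>e\<in>E. if e \<subseteq> S then we e else 0)"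
    by (intro sum.cong) auto
  finally show ?thesis
    using assms(1,3) by (simp add: sum.If_cases Int_def)
qed

text \<open>At a 0/1 vector every Handelman term is 0 or 1, so no nonnegative combination is
  negative.\<close>

lemma eval_indicator_handelman_set_nonneg:
  assumes "finite V" "f \<in> handelman_set V t"
  shows "0 \<le> eval_indicator S f"
proof -
  obtain c where c: "\<And>T I. 0 \<le> c T I" "f = (\<Sum>T | T \<subseteq> V \<and> card T \<le> t.
      \<Sum>I\<in>Pow T. mpoly_const (c T I) * handelman_term T I)"
    using assms(2) unfolding handelman_set_def by auto
  have "eval_indicator S f = (\<Sum>T | T \<subseteq> V \<and> card T \<le> t.
      \<Sum>I\<in>Pow T. c T I * of_bool (T \<inter> S = I))"
    unfolding c(2) eval_indicator_sum eval_indicator_mult eval_indicator_const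
    using assms(1) finite_subset
    by (intro sum.cong refl) (subst eval_indicator_handelman_term, auto)
  also have "\<dots> \<ge> 0" using c(1) by (intro sum_nonneg) auto
  finally show ?thesis .
qed

text \<open>Divided by \<open>t\<close>, this functional maps \<open>1\<close> to \<open>1\<close>, every variable to \<open>1 / t\<close>, and every product of
  two or more distinct variables to \<open>0\<close>.\<close>

lemma pseudo_expectation_nonneg:
  assumes "finite V" "1 \<le> t" "f \<in> handelman_set V t"
  shows "0 \<le> (real t - card V) * eval_indicator {} f + (\<Sum>v\<in>V. eval_indicator {v} f)"
proof -
  obtain c where c: "\<And>T I. 0 \<le> c T I" "f = (\<Sum>T | T \<subseteq> V \<and> card T \<le> t.
      \<Sum>I\<in>Pow T. mpoly_const (c T I) * handelman_term T I)"
    using assms(3) unfolding handelman_set_def by auto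
  let ?L = "\<lambda>g. (real t - card V) * eval_indicator {} g + (\<Sum>v\<in>V. eval_indicator {v} g)"
  have "(\<Sum>v\<in>V. eval_indicator {v} f) =
      (\<Sum>v\<in>V. \<Sum>T | T \<subseteq> V \<and> card T \<le> t. \<Sum>I\<in>Pow T. c T I * eval_indicator {v} (handelman_term T I))"
    unfolding c(2) by simp
  also have "\<dots> = (\<Sum>T | T \<subseteq> V \<and> card T \<le> t. \<Sum>I\<in>Pow T. \<Sum>v\<in>V. c T I * eval_indicator {v} (handelman_term T I))"
    by (subst sum.swap, intro sum.cong refl, rule sum.swap)
  finally have "?L f = (\<Sum>T | T \<subseteq> V \<and> card T \<le> t. \<Sum>I\<in>Pow T. c T I * ?L (handelman_term T I))"
    unfolding c(2) by (simp add: sum_distrib_left sum.distrib distrib_left mult_ac)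
  also have "\<dots> \<ge> 0"
  proof (intro sum_nonneg mult_nonneg_nonneg c(1))
    fix T I assume "T \<in> {T. T \<subseteq> V \<and> card T \<le> t}" "I \<in> Pow T"
    then have T: "T \<subseteq> V" "card T \<le> t" "I \<subseteq> T" "finite T" using assms(1) finite_subset by auto
    show "0 \<le> ?L (handelman_term T I)"
    proof (cases "I = {}")
      case True
      \<comment> \<open>For \<open>I = {}\<close> the functional takes the value
        \<open>(t - card V) + (card V - card T) = t - card T\<close>, which is nonnegative by the
        order bound.\<close>
      have "(\<Sum>v\<in>V. of_bool (v \<notin> T) :: real) = card (V - T)"
        using assms(1) by (simp add: of_bool_def sum.If_cases Diff_eq Compl_eq)
      also have "\<dots> = real (card V) - card T"
        using T assms(1) by (simp add: card_Diff_subset of_nat_diff card_mono)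
      finally show ?thesis
        using T by (simp add: eval_indicator_handelman_term True)
    next
      case False
      \<comment> \<open>The value at \<open>{}\<close> is 0, so the possibly negative factor
        \<open>t - card V\<close> has no effect.\<close>
      then show ?thesis
        using T by (simp add: eval_indicator_handelman_term sum_nonneg)
    qed
  qed
  finally show ?thesis .
qed

section \<open>The Handelman rank\<close>

context
  fixes V :: "'a set" and E :: "'a set set"
  assumes graph: "finite_simple_graph V E"
begin

lemmas finV = finite_vertices[OF graph] and finE = finite_edges[OF graph]

section \<open>Lower estimates of the Handelman bound\<close>

lemma edge_not_subset_indep:
  assumes "indep S E" "e \<in> E"
  shows "\<not> e \<subseteq> S"
  using assms card_edge[OF graph assms(2)] by (auto simp: card_2_iff indep_def)

text \<open>On a maximum weight stable set \<open>S\<close> no edge term survives, so evaluation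
  there turns membership at any order into \<open>0 \<le> r - sum w S\<close>.\<close>

lemma handelman_bound_ge:
  "ereal (weighted_stability_number V E w) \<le> handelman_bound V E w we t"
  unfolding handelman_bound_def
proof (intro INF_greatest)
  fix r assume "r \<in> {r. mpoly_const r - stable_set_poly V E w we \<in> handelman_set V t}"
  then have r: "mpoly_const r - stable_set_poly V E w we \<in> handelman_set V t" by simp
  obtain S where S: "S \<subseteq> V" "indep S E" "sum w S = weighted_stability_number V E w"
    using weighted_stability_number_attained[OF graph] .
  have "finite e" if "e \<in> E" for e
    using edge_subset[OF graph that] finV finite_subset by blast
  moreover have "sum we {e \<in> E. e \<subseteq> S} = 0"
    using edge_not_subset_indep[OF S(2)] by (intro sum.neutral) blast
  ultimately have "eval_indicator S (mpoly_const r - stable_set_poly V E w we) = r - sum w S"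
    using S(1) finV finE by (simp add: eval_indicator_stable_set_poly Int_absorb1)
  then show "ereal (weighted_stability_number V E w) \<le> ereal r"
    using eval_indicator_handelman_set_nonneg[OF finV r, of S] S(3) by simp
qed

text \<open>The functional of \<open>pseudo_expectation_nonneg\<close> sees only sets of at most one
  vertex, which contain no edge; for feasible \<open>r\<close> it gives
  \<open>0 \<le> t * r - sum w V\<close>.\<close>

lemma handelman_bound_ge_sum_div:
  assumes "1 \<le> t"
  shows "ereal (sum w V / t) \<le> handelman_bound V E w we t"
  unfolding handelman_bound_def
proof (intro INF_greatest)
  fix r assume "r \<in> {r. mpoly_const r - stable_set_poly V E w we \<in> handelman_set V t}"
  then have r: "mpoly_const r - stable_set_poly V E w we \<in> handelman_set V t" by simp
  have fin_edge: "finite e" if "e \<in> E" for e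
    using edge_subset[OF graph that] finV finite_subset by blast
  have eval: "eval_indicator S (mpoly_const r - stable_set_poly V E w we) = r - sum w S"
    if "S \<subseteq> V" "card S \<le> 1" for S
  proof -
    have "\<not> e \<subseteq> S" if "e \<in> E" for e
      using card_edge[OF graph that] card_mono[OF finite_subset[OF \<open>S \<subseteq> V\<close> finV], of e] \<open>card S \<le> 1\<close>
      by auto
    then have "sum we {e \<in> E. e \<subseteq> S} = 0" by (intro sum.neutral) blast
    then show ?thesis
      using that(1) finV finE fin_edge by (simp add: eval_indicator_stable_set_poly Int_absorb1)
  qed
  have "0 \<le> (real t - card V) * r + (\<Sum>v\<in>V. r - w v)"
    using pseudo_expectation_nonneg[OF finV assms r] by (simp add: eval del: eval_indicator_diff)
  then have "sum w V \<le> t * r"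
    by (simp add: sum_subtractf algebra_simps)
  then show "ereal (sum w V / t) \<le> ereal r"
    using assms by (simp add: pos_divide_le_eq mult.commute)
qed

text \<open>The clique polynomials \<open>Q K\<close>, weighted by \<open>y K\<close>, reproduce the
  constant and the linear part exactly; on each edge they leave the surplus
  \<open>we e - z e\<close>, which is nonnegative.\<close>

lemma stable_set_poly_certificate:
  fixes w :: "'a \<Rightarrow> real"
  assumes "perfect_graph V E"
    and w: "\<And>i. i \<in> V \<Longrightarrow> 0 \<le> w i"
    and we: "\<And>i j. {i, j} \<in> E \<Longrightarrow> max (w i) (w j) \<le> we {i, j}"
  shows "mpoly_const (weighted_stability_number V E w) - stable_set_poly V E w we
    \<in> handelman_set V (clique_number V E)"
proof -
  let ?H = "handelman_set V (clique_number V E)"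
  obtain y where y: "\<And>K. 0 \<le> y K" "\<And>K. K \<subseteq> V \<Longrightarrow> y K \<noteq> 0 \<Longrightarrow> clique K E"
    "\<And>v. v \<in> V \<Longrightarrow> w v = (\<Sum>K | K \<subseteq> V \<and> v \<in> K. y K)"
    "weighted_stability_number V E w = (\<Sum>K\<in>Pow V. y K)"
    using clique_decomposition[OF graph assms(1), of w] w by blast
  define X :: "'a set \<Rightarrow> 'a real_mpoly" where "X e = (\<Prod>i\<in>e. mpoly_var i)" for e
  define Q where "Q K = 1 - (\<Sum>i\<in>K. mpoly_var i) + (\<Sum>e | e \<in> E \<and> e \<subseteq> K. X e)" for K
  define z where "z e = (\<Sum>K | K \<subseteq> V \<and> e \<subseteq> K. y K)" for e
  \<comment> \<open>\<open>Q K\<close> is a clique polynomial only if \<open>K\<close> is a clique;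
    every other \<open>K\<close> has coefficient 0.\<close>
  have "mpoly_const (y K) * Q K \<in> ?H" if "K \<subseteq> V" for K
  proof (cases "y K = 0")
    case True
    then show ?thesis by (simp add: zero_in_handelman_set)
  next
    case False
    then have K: "clique K E" using y(2) that by blast
    have "{e. e \<in> E \<and> e \<subseteq> K} = [K]\<^bsup>2\<^esup>"
    proof
      show "{e. e \<in> E \<and> e \<subseteq> K} \<subseteq> [K]\<^bsup>2\<^esup>"
        using graph by (auto simp: finite_simple_graph_def nsets_def)
      show "[K]\<^bsup>2\<^esup> \<subseteq> {e. e \<in> E \<and> e \<subseteq> K}"
        using K by (auto simp: clique_def elim!: nsets2_E)
    qed
    then show ?thesis
      using clique_poly_in_handelman_set[OF finV that card_clique_le_clique_number[OF graph subset_refl that K]]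
        y(1) by (auto simp: Q_def X_def intro!: handelman_set_scale)
  qed
  then have cliques: "(\<Sum>K\<in>Pow V. mpoly_const (y K) * Q K) \<in> ?H"
    by (intro handelman_set_sum) auto
  have "mpoly_const (we e - z e) * X e \<in> ?H" if e: "e \<in> E" for e
  proof -
    obtain i j where ij: "e = {i, j}" "i \<noteq> j"
      using card_edge[OF graph e] by (auto simp: card_2_iff)
    have V: "e \<subseteq> V" using edge_subset[OF graph e] .
    have "clique e E" using e ij by (auto simp: clique_def insert_commute)
    then have "card e \<le> clique_number V E"
      using card_clique_le_clique_number[OF graph subset_refl V] by blast
    \<comment> \<open>Every \<open>K\<close> containing \<open>e\<close> contains \<open>i\<close>,
      so \<open>z e \<le> w i \<le> we e\<close>.\<close>
    moreover have "z e \<le> (\<Sum>K | K \<subseteq> V \<and> i \<in> K. y K)"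
      unfolding z_def using finV y(1) ij by (intro sum_mono2) auto
    then have "z e \<le> we e" using y(3)[of i] V ij we[of i j] e by auto
    moreover have "X e = handelman_term e e" by (simp add: X_def handelman_term_def)
    ultimately show ?thesis
      using handelman_term_in_handelman_set[OF finV V] by simp
  qed
  then have edges: "(\<Sum>e\<in>E. mpoly_const (we e - z e) * X e) \<in> ?H"
    by (rule handelman_set_sum)
  have "(\<Sum>K\<in>Pow V. \<Sum>i\<in>K. mpoly_const (y K) * mpoly_var i) =
      (\<Sum>K\<in>Pow V. \<Sum>i | i \<in> V \<and> i \<in> K. mpoly_const (y K) * mpoly_var i)"
    by (intro sum.cong) auto
  also have "\<dots> = (\<Sum>i\<in>V. \<Sum>K | K \<in> Pow V \<and> i \<in> K. mpoly_const (y K) * mpoly_var i)"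
    using finV by (intro sum.swap_restrict) auto
  also have "\<dots> = (\<Sum>i\<in>V. mpoly_const (w i) * mpoly_var i)"
    using y(3) by (intro sum.cong) (auto simp: mpoly_const_sum sum_distrib_right)
  finally have vertices: "(\<Sum>K\<in>Pow V. mpoly_const (y K) * (\<Sum>i\<in>K. mpoly_var i)) =
      (\<Sum>i\<in>V. mpoly_const (w i) * mpoly_var i)"
    by (simp add: sum_distrib_left)
  have "(\<Sum>K\<in>Pow V. \<Sum>e | e \<in> E \<and> e \<subseteq> K. mpoly_const (y K) * X e) =
      (\<Sum>e\<in>E. \<Sum>K | K \<in> Pow V \<and> e \<subseteq> K. mpoly_const (y K) * X e)"
    using finV finE by (intro sum.swap_restrict) auto
  also have "\<dots> = (\<Sum>e\<in>E. mpoly_const (z e) * X e)"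
    by (simp add: z_def mpoly_const_sum sum_distrib_right)
  finally have pairs: "(\<Sum>K\<in>Pow V. mpoly_const (y K) * (\<Sum>e | e \<in> E \<and> e \<subseteq> K. X e)) =
      (\<Sum>e\<in>E. mpoly_const (z e) * X e)"
    by (simp add: sum_distrib_left)
  have "(\<Sum>K\<in>Pow V. mpoly_const (y K) * Q K) = mpoly_const (weighted_stability_number V E w) -
      (\<Sum>i\<in>V. mpoly_const (w i) * mpoly_var i) + (\<Sum>e\<in>E. mpoly_const (z e) * X e)"
    unfolding Q_def distrib_left right_diff_distrib sum.distrib sum_subtractf vertices pairs y(4)
    by (simp add: mpoly_const_sum)
  then have "mpoly_const (weighted_stability_number V E w) - stable_set_poly V E w we =
      (\<Sum>K\<in>Pow V. mpoly_const (y K) * Q K) + (\<Sum>e\<in>E. mpoly_const (we e - z e) * X e)"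
    by (simp add: stable_set_poly_def X_def mpoly_const_diff left_diff_distrib sum_subtractf)
  then show ?thesis using handelman_set_add[OF cliques edges] by simp
qed

text \<open>The rank admits only orders \<open>t \<ge> 1\<close>, so the clique number has to
  qualify as one.\<close>

lemma clique_number_pos:
  assumes "V \<noteq> {}"
  shows "1 \<le> clique_number V E"
proof -
  obtain v where "v \<in> V" using assms by blast
  then show ?thesis using card_clique_le_clique_number[OF graph subset_refl, of "{v}" E] by simp
qed

lemma handelman_rank_le_clique_number:
  fixes w :: "'a \<Rightarrow> real"
  assumes "V \<noteq> {}" "perfect_graph V E"
    and "\<And>i. i \<in> V \<Longrightarrow> 0 \<le> w i"
    and "\<And>i j. {i, j} \<in> E \<Longrightarrow> max (w i) (w j) \<le> we {i, j}"
  shows "handelman_rank V E w we \<le> enat (clique_number V E)"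
proof -
  have "handelman_bound V E w we (clique_number V E) \<le> ereal (weighted_stability_number V E w)"
    unfolding handelman_bound_def
    using stable_set_poly_certificate[of w we] assms(2-4) by (intro INF_lower) simp
  then have "handelman_bound V E w we (clique_number V E) = ereal (weighted_stability_number V E w)"
    using handelman_bound_ge by (rule antisym)
  then show ?thesis
    unfolding handelman_rank_def using clique_number_pos[OF assms(1)] by (intro INF_lower) simp
qed

section \<open>Vertex-transitive graphs and the matching lower bound\<close>

lemma graph_automorphism_image_clique:
  assumes "graph_automorphism V E f" "K \<subseteq> V" "clique K E"
  shows "f ` K \<subseteq> V" "clique (f ` K) E" "card (f ` K) = card K"
proof -
  have f: "inj_on f V" "f ` V = V" "\<And>u v. u \<in> V \<Longrightarrow> v \<in> V \<Longrightarrow> {u, v} \<in> E \<longleftrightarrow> {f u, f v} \<in> E"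
    using assms(1) by (auto simp: graph_automorphism_def bij_betw_def)
  show "f ` K \<subseteq> V" using f(2) assms(2) by blast
  show "clique (f ` K) E"
    unfolding clique_def
  proof (intro ballI impI)
    fix a b assume "a \<in> f ` K" "b \<in> f ` K" "a \<noteq> b"
    then obtain u v where uv: "u \<in> K" "v \<in> K" "a = f u" "b = f v" "u \<noteq> v" by blast
    then have "{u, v} \<in> E" using assms(3) by (auto simp: clique_def)
    then show "{a, b} \<in> E" using f(3)[of u v] uv assms(2) by auto
  qed
  show "card (f ` K) = card K"
    using inj_on_subset[OF f(1) assms(2)] by (rule card_image)
qed

text \<open>All vertices lie in the same number \<open>d\<close> of maximum cliques, and a stable set meets
  each maximum clique at most once; so \<open>d\<close> times its size is at most the number of maximum cliques.\<close>

lemma vertex_transitive_clique_number_mult_card_indep_le: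
  assumes "vertex_transitive V E" "V \<noteq> {}" "S \<subseteq> V" "indep S E"
  shows "clique_number V E * card S \<le> card V"
proof -
  let ?\<omega> = "clique_number V E"
  define \<K> where "\<K> = {K. K \<subseteq> V \<and> clique K E \<and> card K = ?\<omega>}"
  define d where "d v = card {K \<in> \<K>. v \<in> K}" for v
  have fin: "finite \<K>" using finV by (simp add: \<K>_def)
  \<comment> \<open>An automorphism taking \<open>u\<close> to \<open>v\<close> maps the maximum
    cliques through \<open>u\<close> injectively to those through \<open>v\<close>; exchanging
    \<open>u\<close> and \<open>v\<close> gives equality.\<close>
  have d_le: "d u \<le> d v" if uv: "u \<in> V" "v \<in> V" for u v
  proof -
    obtain f where f: "graph_automorphism V E f" "f u = v"
      using assms(1) uv unfolding vertex_transitive_def by blast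
    have "inj_on f V" using f(1) by (simp add: graph_automorphism_def bij_betw_def)
    then have "inj_on ((`) f) {K \<in> \<K>. u \<in> K}"
      by (intro inj_onI) (auto simp: \<K>_def inj_on_image_eq_iff)
    moreover have "(`) f ` {K \<in> \<K>. u \<in> K} \<subseteq> {K \<in> \<K>. v \<in> K}"
      using graph_automorphism_image_clique[OF f(1)] f(2) by (auto simp: \<K>_def)
    ultimately show ?thesis
      unfolding d_def using fin by (intro card_inj_on_le) auto
  qed
  obtain v where v: "v \<in> V" using assms(2) by blast
  have d: "d u = d v" if "u \<in> V" for u
    using d_le that v by (simp add: antisym)
  have "(\<Sum>u\<in>V. d u) = (\<Sum>K\<in>\<K>. card {u \<in> V. u \<in> K})"
    unfolding d_def using sum_multicount_gen[OF finV fin, of "(\<in>)" "\<lambda>K. card {u \<in> V. u \<in> K}"] by simp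
  also have "\<dots> = (\<Sum>K\<in>\<K>. ?\<omega>)"
    by (intro sum.cong) (auto simp: \<K>_def Int_def[symmetric] Int_absorb1 simp flip: Collect_conj_eq)
  finally have all: "card V * d v = card \<K> * ?\<omega>" using d by simp
  have "finite S" using assms(3) finV finite_subset by blast
  have "(\<Sum>u\<in>S. d u) = (\<Sum>K\<in>\<K>. card {u \<in> S. u \<in> K})"
    unfolding d_def using sum_multicount_gen[OF \<open>finite S\<close> fin, of "(\<in>)" "\<lambda>K. card {u \<in> S. u \<in> K}"] by simp
  also have "\<dots> \<le> (\<Sum>K\<in>\<K>. 1)"
    using card_clique_Int_indep_le_1[OF _ assms(4)]
    by (intro sum_mono) (auto simp: \<K>_def Int_def conj_commute)
  moreover have "(\<Sum>u\<in>S. d u) = card S * d v"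
    using d assms(3) by (subst sum.cong[OF refl, of _ _ "\<lambda>_. d v"]) auto
  ultimately have S: "card S * d v \<le> card \<K>" by simp
  obtain K where "K \<in> \<K>"
    using clique_number_attained[OF graph subset_refl, of E] by (auto simp: \<K>_def)
  \<comment> \<open>A maximum clique exists and is nonempty, so \<open>d v\<close> is positive and
    can be cancelled at the end.\<close>
  then have "card \<K> * ?\<omega> > 0"
    using fin clique_number_pos[OF assms(2)] by (auto simp: card_gt_0_iff)
  then have "d v > 0" using all by (metis mult_is_0 neq0_conv)
  moreover have "d v * (?\<omega> * card S) \<le> d v * card V"
    using mult_right_mono[OF S, of ?\<omega>] all by (simp add: mult_ac)
  ultimately show ?thesis by simp
qed

text \<open>At an exact order \<open>t\<close> the stability number \<open>\<alpha>\<close>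
  satisfies \<open>card V \<le> t * \<alpha>\<close>, while transitivity gives
  \<open>\<omega> * \<alpha> \<le> card V\<close>; cancelling \<open>\<alpha>\<close> leaves
  \<open>\<omega> \<le> t\<close>.\<close>

lemma clique_number_le_handelman_rank:
  assumes "vertex_transitive V E" "V \<noteq> {}"
  shows "enat (clique_number V E) \<le> handelman_rank V E (\<lambda>_. 1) (\<lambda>_. 1)"
  unfolding handelman_rank_def
proof (intro INF_greatest)
  let ?\<omega> = "clique_number V E" and ?\<alpha> = "weighted_stability_number V E (\<lambda>_. 1)"
  fix t assume "t \<in> {t. 1 \<le> t \<and> handelman_bound V E (\<lambda>_. 1) (\<lambda>_. 1) t = ereal ?\<alpha>}"
  then have t: "1 \<le> t" "handelman_bound V E (\<lambda>_. 1) (\<lambda>_. 1) t = ereal ?\<alpha>" by auto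
  have "card V / t \<le> ?\<alpha>"
    using handelman_bound_ge_sum_div[OF t(1), of "\<lambda>_. 1" "\<lambda>_. 1"] t(2) by simp
  then have card_le: "card V \<le> t * ?\<alpha>" using t(1) by (simp add: pos_divide_le_eq mult.commute)
  obtain S where S: "S \<subseteq> V" "indep S E" "(\<Sum>v\<in>S. 1) = ?\<alpha>"
    using weighted_stability_number_attained[OF graph] .
  have "?\<omega> * card S \<le> card V"
    using vertex_transitive_clique_number_mult_card_indep_le[OF assms S(1,2)] .
  moreover have "real (card V) \<le> real (t * card S)"
    using card_le S(3) by simp
  then have "card V \<le> t * card S" by (simp only: of_nat_le_iff)
  ultimately have "?\<omega> * card S \<le> t * card S" by (rule le_trans)
  \<comment> \<open>Cancelling \<open>card S\<close> requires it to be positive; otherwise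
    \<open>card V \<le> t * card S\<close> would force \<open>V = {}\<close>.\<close>
  moreover have "card V > 0" using assms(2) finV by (simp add: card_gt_0_iff)
  then have "card S > 0" using \<open>card V \<le> t * card S\<close> by (cases "card S") auto
  ultimately show "enat ?\<omega> \<le> enat t" by simp
qed

end

theorem proposition5:
  fixes V :: "'a set" and E :: "'a set set"
  assumes "finite_simple_graph V E" and "V \<noteq> {}" and "perfect_graph V E"
  shows "(\<forall>(w :: 'a \<Rightarrow> real) (we :: 'a set \<Rightarrow> real).
            (\<forall>i\<in>V. 0 \<le> w i) \<and> (\<forall>i j. {i, j} \<in> E \<longrightarrow> max (w i) (w j) \<le> we {i, j}) \<longrightarrow>
            handelman_rank V E w we \<le> enat (clique_number V E)) \<and>
         (vertex_transitive V E \<longrightarrow>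
            handelman_rank V E (\<lambda>_. 1) (\<lambda>_. 1) = enat (clique_number V E))"
proof (intro conjI allI impI)
  fix w :: "'a \<Rightarrow> real" and we :: "'a set \<Rightarrow> real"
  assume w: "(\<forall>i\<in>V. 0 \<le> w i) \<and> (\<forall>i j. {i, j} \<in> E \<longrightarrow> max (w i) (w j) \<le> we {i, j})"
  show "handelman_rank V E w we \<le> enat (clique_number V E)"
    by (rule handelman_rank_le_clique_number[OF assms]) (use w in blast)+
next
  assume "vertex_transitive V E"
  show "handelman_rank V E (\<lambda>_. 1) (\<lambda>_. 1) = enat (clique_number V E)"
  proof (rule antisym)
    show "handelman_rank V E (\<lambda>_. 1) (\<lambda>_. 1) \<le> enat (clique_number V E)"
      by (rule handelman_rank_le_clique_number[OF assms]) simp_all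
    show "enat (clique_number V E) \<le> handelman_rank V E (\<lambda>_. 1) (\<lambda>_. 1)"
      using assms(1) \<open>vertex_transitive V E\<close> assms(2) by (rule clique_number_le_handelman_rank)
  qed
qed

end
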